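(* Let $(W,S)$ be a Coxeter system and $I_\bullet=[J_0,\dots,J_d]$ a (single-step) singular expression, with corresponding multistep expression $$[[I_0\subset K_1\supset I_1\subset K_2\supset\cdots\subset K_m\supset I_m]].$$ Then the following two criteria for reducedness of $I_\bullet$ are equivalent. (a) With $y_i=w_{J_i}w_{J_i\cap J_{i+1}}^{-1}$ $(0\le i\le d-1)$ and $z_i=w_{J_{i-1}\cap J_i}^{-1}w_{J_i}$ $(1\le i\le d)$, for some (equivalently, for all) $0\le k\le d$ the lengths add in the product $y_0y_1\cdots y_{k-1}\,w_{J_k}\,z_{k+1}\cdots z_d$, i.e. the length of this product is the sum of the lengths of its factors. (b) $\ell_W(w_{K_1}w_{I_1}^{-1}w_{K_2}\cdots w_{I_{m-1}}^{-1}w_{K_m})=\ell_W(w_{K_1})-\ell_W(w_{I_1})+\ell_W(w_{K_2})-\cdots-\ell_W(w_{I_{m-1}})+\ell_W(w_{K_m})$.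
   Context: Let $(W,S)$ be a Coxeter system with length function $\ell_W$. For $I\subset S$ let $W_I$ be the parabolic subgroup generated by $I$; $I$ is finitary if $W_I$ is finite, and then $w_I$ is the longest element of $W_I$. A (single-step) singular expression is a sequence $[J_0,\dots,J_d]$ of finitary subsets of $S$ such that consecutive ones differ by adding or removing exactly one element of $S$. The corresponding multistep expression $[[I_0\subset K_1\supset I_1\subset\cdots\subset K_m\supset I_m]]$ is obtained by recording only the endpoints of the maximal runs of additions and the maximal runs of removals: $I_0=J_0$, $K_1$ is the end of the initial run of additions (with $K_1=I_0$ if the expression begins with a removal or has $d=0$), $I_1$ is the end of the next run of removals, and so on, with $I_m=J_d$ (and $I_m=K_m$ if the expression ends with an addition or has $d=0$). *)

theory Defs
  imports "HOL-Algebra.Algebra"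
begin

definition list_prod :: "('a, 'b) monoid_scheme \<Rightarrow> 'a list \<Rightarrow> 'a" where
  "list_prod W xs = foldr (\<otimes>\<^bsub>W\<^esub>) xs \<one>\<^bsub>W\<^esub>"

(* The congruence on words over S generated by the relations (st)^m(s,t) = 1, where m(s,t)
   is the order of st in W.  group.ord is 0 for elements of infinite order, so such pairs
   contribute only the trivial relation.  The case s = t with m(s,s) = 1 makes every generator
   its own inverse, so no formal inverses are needed and the quotient monoid is the group
   presented by S and these relations. *)
inductive coxeter_cong :: "('a, 'b) monoid_scheme \<Rightarrow> 'a set \<Rightarrow> 'a list \<Rightarrow> 'a list \<Rightarrow> bool"
  for W :: "('a, 'b) monoid_scheme" and S :: "'a set" where
  refl: "u \<in> lists S \<Longrightarrow> coxeter_cong W S u u"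
| sym: "coxeter_cong W S u v \<Longrightarrow> coxeter_cong W S v u"
| trans: "coxeter_cong W S u v \<Longrightarrow> coxeter_cong W S v x \<Longrightarrow> coxeter_cong W S u x"
| relation: "u \<in> lists S \<Longrightarrow> v \<in> lists S \<Longrightarrow> s \<in> S \<Longrightarrow> t \<in> S \<Longrightarrow>
    coxeter_cong W S (u @ concat (replicate (group.ord W (s \<otimes>\<^bsub>W\<^esub> t)) [s, t]) @ v) (u @ v)"

(* S is a set of involutions generating W, and the relations (st)^m(s,t) = 1 form a
   presentation of W.  S is not required to be finite. *)
definition coxeter_system :: "('a, 'b) monoid_scheme \<Rightarrow> 'a set \<Rightarrow> bool" where
  "coxeter_system W S \<longleftrightarrow>
     group W \<and> S \<subseteq> carrier W \<and> (\<forall>s\<in>S. group.ord W s = 2) \<and> generate W S = carrier W \<and>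
     (\<forall>u\<in>lists S. \<forall>v\<in>lists S. list_prod W u = list_prod W v \<longleftrightarrow> coxeter_cong W S u v)"

definition cox_length :: "('a, 'b) monoid_scheme \<Rightarrow> 'a set \<Rightarrow> 'a \<Rightarrow> nat" where
  "cox_length W S w = (LEAST n. \<exists>u\<in>lists S. length u = n \<and> list_prod W u = w)"

definition finitary :: "('a, 'b) monoid_scheme \<Rightarrow> 'a set \<Rightarrow> 'a set \<Rightarrow> bool" where
  "finitary W S I \<longleftrightarrow> I \<subseteq> S \<and> finite (generate W I)"

definition longest :: "('a, 'b) monoid_scheme \<Rightarrow> 'a set \<Rightarrow> 'a set \<Rightarrow> 'a" where
  "longest W S I =
     (THE w. w \<in> generate W I \<and> (\<forall>v\<in>generate W I. cox_length W S v \<le> cox_length W S w))"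

definition singular_expression :: "('a, 'b) monoid_scheme \<Rightarrow> 'a set \<Rightarrow> 'a set list \<Rightarrow> bool" where
  "singular_expression W S J \<longleftrightarrow>
     J \<noteq> [] \<and> (\<forall>I\<in>set J. finitary W S I) \<and>
     (\<forall>i. Suc i < length J \<longrightarrow>
        (\<exists>s\<in>S. s \<notin> J ! i \<and> J ! Suc i = insert s (J ! i) \<or>
               s \<in> J ! i \<and> J ! Suc i = J ! i - {s}))"

(* Both functions scan a singular expression from left to right and record the current set at
   the end of each maximal run: ascent_ends while in a run of additions, descent_ends while in a
   run of removals.  An expression that ends during a run of additions still has a last (empty)
   run of removals, so its final set is recorded twice. *)
fun ascent_ends descent_ends :: "'a set list \<Rightarrow> 'a set list" where
  "ascent_ends [] = []"
| "ascent_ends [J] = [J, J]"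
| "ascent_ends (J # J' # Js) =
     (if J \<subset> J' then ascent_ends (J' # Js) else J # descent_ends (J' # Js))"
| "descent_ends [] = []"
| "descent_ends [J] = [J]"
| "descent_ends (J # J' # Js) =
     (if J' \<subset> J then descent_ends (J' # Js) else J # ascent_ends (J' # Js))"

(* The multistep expression as the list [I_0, K_1, I_1, ..., K_m, I_m] of length 2 m + 1. *)
definition multistep :: "'a set list \<Rightarrow> 'a set list" where
  "multistep J = hd J # ascent_ends J"

definition multistep_m :: "'a set list \<Rightarrow> nat" where
  "multistep_m J = length (multistep J) div 2"

definition multistep_K :: "'a set list \<Rightarrow> nat \<Rightarrow> 'a set" where
  "multistep_K J i = multistep J ! (2 * i - 1)"

definition multistep_I :: "'a set list \<Rightarrow> nat \<Rightarrow> 'a set" where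
  "multistep_I J i = multistep J ! (2 * i)"

definition y_factor :: "('a, 'b) monoid_scheme \<Rightarrow> 'a set \<Rightarrow> 'a set list \<Rightarrow> nat \<Rightarrow> 'a" where
  "y_factor W S J i =
     longest W S (J ! i) \<otimes>\<^bsub>W\<^esub> inv\<^bsub>W\<^esub> (longest W S (J ! i \<inter> J ! (i + 1)))"

definition z_factor :: "('a, 'b) monoid_scheme \<Rightarrow> 'a set \<Rightarrow> 'a set list \<Rightarrow> nat \<Rightarrow> 'a" where
  "z_factor W S J i =
     inv\<^bsub>W\<^esub> (longest W S (J ! (i - 1) \<inter> J ! i)) \<otimes>\<^bsub>W\<^esub> longest W S (J ! i)"

definition lengths_add :: "('a, 'b) monoid_scheme \<Rightarrow> 'a set \<Rightarrow> 'a list \<Rightarrow> bool" where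
  "lengths_add W S xs \<longleftrightarrow>
     cox_length W S (list_prod W xs) = (\<Sum>x\<leftarrow>xs. cox_length W S x)"

(* [y_0, ..., y_(k-1), w_(J_k), z_(k+1), ..., z_d] for an expression J_0, ..., J_d *)
definition factors_at :: "('a, 'b) monoid_scheme \<Rightarrow> 'a set \<Rightarrow> 'a set list \<Rightarrow> nat \<Rightarrow> 'a list" where
  "factors_at W S J k =
     map (y_factor W S J) [0..<k] @ [longest W S (J ! k)] @
     map (z_factor W S J) [k + 1..<length J]"

(* w_(K_1) w_(I_1)^-1 w_(K_2) ... w_(I_(m-1))^-1 w_(K_m) *)
definition multistep_prod :: "('a, 'b) monoid_scheme \<Rightarrow> 'a set \<Rightarrow> 'a set list \<Rightarrow> 'a" where
  "multistep_prod W S J =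
     list_prod W
       (concat (map (\<lambda>i. [longest W S (multistep_K J i),
                          inv\<^bsub>W\<^esub> (longest W S (multistep_I J i))]) [1..<multistep_m J]))
     \<otimes>\<^bsub>W\<^esub> longest W S (multistep_K J (multistep_m J))"

(* Stated over int because the right-hand side contains genuine subtractions. *)
definition multistep_length_formula :: "('a, 'b) monoid_scheme \<Rightarrow> 'a set \<Rightarrow> 'a set list \<Rightarrow> bool" where
  "multistep_length_formula W S J \<longleftrightarrow>
     int (cox_length W S (multistep_prod W S J)) =
       (\<Sum>i = 1..multistep_m J. int (cox_length W S (longest W S (multistep_K J i))))
       - (\<Sum>i = 1..<multistep_m J. int (cox_length W S (longest W S (multistep_I J i))))"

end

theory Submission
  imports Defs
begin

text \<open>
  The equivalence holds because lengths of longest elements behave like the elements themselves: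
  if \<open>x\<close> lies in a finite parabolic subgroup \<open>W\<^sub>I\<close>, then multiplying \<open>w\<^sub>I\<close> by \<open>x\<close> on either side lowers the length by exactly
  \<open>\<ell>(x)\<close>. Hence \<open>\<ell>(y\<^sub>i) = \<ell>(w\<^bsub>J\<^sub>i\<^esub>) - \<ell>(w\<^bsub>J\<^sub>i \<inter> J\<^sub>i\<^sub>+\<^sub>1\<^esub>)\<close>, and similarly for \<open>z\<^sub>i\<close>.
  Criterion (a) therefore compares the length of an alternating product, formed in \<open>W\<close> from the
  \<open>w\<^sub>I\<close>, with the same alternating product formed in the additive group of integers from the
  \<open>\<ell>(w\<^sub>I)\<close>; and so does criterion (b), for a shorter alternating product.
  It remains to see that, in an arbitrary group and for arbitrary values attached to the sets,
  the product in (a) does not depend on \<open>k\<close> and agrees with the product in (b)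
  (\<open>list_prod_slices\<close> and \<open>zigzag_eq_alternating\<close>). This is a telescoping: in a run of
  additions \<open>J\<^sub>i \<inter> J\<^sub>i\<^sub>+\<^sub>1 = J\<^sub>i\<close>, in a run of removals \<open>J\<^sub>i \<inter> J\<^sub>i\<^sub>+\<^sub>1 = J\<^sub>i\<^sub>+\<^sub>1\<close>, so that everything
  cancels except at the turning points, which are the sets of the multistep expression.
  Applying this once to \<open>W\<close> and once to the integers gives the equivalence.

  The fact about lengths (\<open>length_longest_mult\<close>) has to be extracted from the presentation of
  \<open>W\<close>. To a word \<open>s\<^sub>1 \<dots> s\<^sub>n\<close> attach the reflections
  \<open>s\<^sub>1 \<dots> s\<^sub>i\<^sub>-\<^sub>1 s\<^sub>i s\<^sub>i\<^sub>-\<^sub>1 \<dots> s\<^sub>1\<close>. The Coxeter relations preserve the parity of the number of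
  occurrences of each reflection, so those occurring an odd number of times form a set \<open>N(w)\<close>
  depending only on the element \<open>w\<close>. It satisfies the cocycle rule
  \<open>N(xy) = N(x) \<triangle> x N(y) x\<^sup>-\<^sup>1\<close>, and \<open>\<ell>(w)\<close> is the cardinality of \<open>N(w)\<close>. An element \<open>w\<close> of
  maximal length in a finite \<open>W\<^sub>I\<close> has \<open>N(w)\<close> equal to the set \<open>T\<^sub>I\<close> of all \<open>W\<^sub>I\<close>-conjugates of
  \<open>I\<close>, since left multiplication by a reflection missing from \<open>N(w)\<close> would increase the length.
  So \<open>w\<close> is unique, and for \<open>x\<close> in \<open>W\<^sub>I\<close> the cocycle rule turns \<open>N(xw)\<close> into \<open>T\<^sub>I - N(x)\<close>.
\<close>

section \<open>Telescoping along an expression\<close>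

context group
begin

lemma inv_mult_cancel_left:
  "x \<in> carrier G \<Longrightarrow> y \<in> carrier G \<Longrightarrow> inv x \<otimes> (x \<otimes> y) = y"
  by (simp flip: m_assoc)

lemma mult_inv_cancel_left:
  "x \<in> carrier G \<Longrightarrow> y \<in> carrier G \<Longrightarrow> x \<otimes> (inv x \<otimes> y) = y"
  by (simp flip: m_assoc)

lemma list_prod_closed: "set xs \<subseteq> carrier G \<Longrightarrow> list_prod G xs \<in> carrier G"
  by (induction xs) (auto simp: list_prod_def)

lemma list_prod_append:
  "set xs \<subseteq> carrier G \<Longrightarrow> set ys \<subseteq> carrier G \<Longrightarrow>
    list_prod G (xs @ ys) = list_prod G xs \<otimes> list_prod G ys"
  by (induction xs) (auto simp: list_prod_def m_assoc list_prod_closed[unfolded list_prod_def])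

end

lemma list_prod_Nil [simp]: "list_prod G [] = \<one>\<^bsub>G\<^esub>"
  by (simp add: list_prod_def)

lemma list_prod_Cons [simp]: "list_prod G (x # xs) = x \<otimes>\<^bsub>G\<^esub> list_prod G xs"
  by (simp add: list_prod_def)

lemma list_prod_integer_group: "list_prod integer_group xs = sum_list xs"
  by (induction xs) auto

text \<open>The factors of criterion (a) for values \<open>f\<close> in any group, so that one computation serves
  both the elements \<open>w\<^sub>I\<close> and their lengths.\<close>

definition slices :: "('g, 'm) monoid_scheme \<Rightarrow> ('a set \<Rightarrow> 'g) \<Rightarrow> 'a set list \<Rightarrow> nat \<Rightarrow> 'g list" where
  "slices G f J k =
     map (\<lambda>i. f (J ! i) \<otimes>\<^bsub>G\<^esub> inv\<^bsub>G\<^esub> f (J ! i \<inter> J ! (i + 1))) [0..<k] @ [f (J ! k)] @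
     map (\<lambda>i. inv\<^bsub>G\<^esub> f (J ! (i - 1) \<inter> J ! i) \<otimes>\<^bsub>G\<^esub> f (J ! i)) [k + 1..<length J]"

fun zigzag :: "('g, 'm) monoid_scheme \<Rightarrow> ('a set \<Rightarrow> 'g) \<Rightarrow> 'a set list \<Rightarrow> 'g" where
  "zigzag G f [] = \<one>\<^bsub>G\<^esub>"
| "zigzag G f [A] = f A"
| "zigzag G f (A # B # Js) = f A \<otimes>\<^bsub>G\<^esub> (inv\<^bsub>G\<^esub> f (A \<inter> B) \<otimes>\<^bsub>G\<^esub> zigzag G f (B # Js))"

text \<open>The product of criterion (b), as a function of the list \<open>K\<^sub>1, I\<^sub>1, \<dots>, K\<^sub>m, I\<^sub>m\<close>.\<close>

fun alternating :: "('g, 'm) monoid_scheme \<Rightarrow> ('a set \<Rightarrow> 'g) \<Rightarrow> 'a set list \<Rightarrow> 'g" where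
  "alternating G f [] = \<one>\<^bsub>G\<^esub>"
| "alternating G f [K] = f K"
| "alternating G f [K, I] = f K"
| "alternating G f (K # I # L # Ls) = f K \<otimes>\<^bsub>G\<^esub> (inv\<^bsub>G\<^esub> f I \<otimes>\<^bsub>G\<^esub> alternating G f (L # Ls))"

lemma slices_Cons_0:
  "slices G f (A # B # Js) 0 =
     f A # (inv\<^bsub>G\<^esub> f (A \<inter> B) \<otimes>\<^bsub>G\<^esub> f B) # tl (slices G f (B # Js) 0)"
proof -
  have "[0 + 1..<length (A # B # Js)] = 1 # map Suc [0 + 1..<length (B # Js)]"
    by (simp add: upt_conv_Cons map_Suc_upt del: upt_Suc)
  then show ?thesis
    by (auto simp: slices_def nth_Cons' simp del: upt_Suc)
qed

lemma slices_Cons_Suc: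
  "slices G f (A # B # Js) (Suc k) =
     (f A \<otimes>\<^bsub>G\<^esub> inv\<^bsub>G\<^esub> f (A \<inter> B)) # slices G f (B # Js) k"
proof -
  have "[Suc k + 1..<length (A # B # Js)] = map Suc [k + 1..<length (B # Js)]"
    by (simp add: map_Suc_upt del: upt_Suc)
  moreover have "[0..<Suc k] = 0 # map Suc [0..<k]"
    by (simp add: upt_conv_Cons map_Suc_upt del: upt_Suc)
  ultimately show ?thesis
    by (auto simp: slices_def nth_Cons' simp del: upt_Suc)
qed

context group
begin

context
  fixes f :: "'c set \<Rightarrow> 'a"
  assumes f_closed: "f A \<in> carrier G"
begin

lemma zigzag_closed: "zigzag G f J \<in> carrier G"
  by (induction J rule: induct_list012) (auto simp: f_closed)

lemma slices_closed: "set (slices G f J k) \<subseteq> carrier G"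
  by (auto simp: slices_def f_closed)

lemma list_prod_slices:
  "k < length J \<Longrightarrow> list_prod G (slices G f J k) = zigzag G f J"
proof (induction J arbitrary: k rule: induct_list012)
  case (3 A B Js)
  show ?case
  proof (cases k)
    case 0
    have hd: "slices G f (B # Js) 0 = f B # tl (slices G f (B # Js) 0)"
      by (simp add: slices_def)
    let ?t = "list_prod G (tl (slices G f (B # Js) 0))"
    have "?t \<in> carrier G"
      using slices_closed[of "B # Js" 0] hd
      by (metis list_prod_closed set_subset_Cons subset_trans)
    moreover have "f B \<otimes> ?t = zigzag G f (B # Js)"
      using "3.IH"(2)[of 0] hd by (metis length_greater_0_conv list.distinct(1) list_prod_Cons)
    ultimately show ?thesis
      using 0 by (simp add: slices_Cons_0 m_assoc f_closed)
  next
    case (Suc k')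
    then show ?thesis
      using "3.IH"(2)[of k'] "3.prems" by (simp add: slices_Cons_Suc m_assoc f_closed zigzag_closed)
  qed
qed (auto simp: slices_def f_closed)

text \<open>The scan that computes the multistep expression is in one of two states. In a run of
  removals the last recorded maximum \<open>K\<close> is still waiting for the minimum that closes the run,
  and until then the inverse of the value at the current set stands in for that at the minimum.\<close>

lemma zigzag_eq_alternating:
  assumes "successively (\<lambda>A B. A \<subseteq> B \<or> B \<subseteq> A) J" "J \<noteq> []"
  shows "zigzag G f J = alternating G f (ascent_ends J)"
proof -
  have nonempty: "ascent_ends (A # Js) \<noteq> []" for A :: "'c set" and Js
    by (induction Js arbitrary: A) auto
  have ascent: "alternating G f (K # I # ascent_ends (A # Js)) =
      f K \<otimes> (inv f I \<otimes> alternating G f (ascent_ends (A # Js)))" for K I A Js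
    using nonempty[of A Js] by (cases "ascent_ends (A # Js)") auto
  have "(J \<noteq> [] \<longrightarrow> successively (\<lambda>A B. A \<subseteq> B \<or> B \<subseteq> A) J \<longrightarrow>
           zigzag G f J = alternating G f (ascent_ends J)) \<and>
        (J \<noteq> [] \<longrightarrow> successively (\<lambda>A B. A \<subseteq> B \<or> B \<subseteq> A) J \<longrightarrow>
          (\<forall>K. f K \<otimes> (inv f (hd J) \<otimes> zigzag G f J) = alternating G f (K # descent_ends J)))"
  proof (induction J rule: induct_list012)
    case 1
    show ?case by simp
  next
    case (2 A)
    show ?case by (simp add: f_closed)
  next
    case (3 A B Js)
    have z: "zigzag G f (B # Js) \<in> carrier G" by (rule zigzag_closed)
    have up: "A \<inter> B = A" if "A \<subseteq> B" using that by auto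
    have down: "A \<inter> B = B" if "B \<subseteq> A" using that by auto
    have zig_up: "zigzag G f (A # B # Js) = zigzag G f (B # Js)" if "A \<subseteq> B"
      using up[OF that] by (simp add: mult_inv_cancel_left f_closed z)
    have zig_down: "zigzag G f (A # B # Js) = f A \<otimes> (inv f B \<otimes> zigzag G f (B # Js))"
      if "B \<subseteq> A"
      using down[OF that] by simp
    have IH_down: "f K \<otimes> (inv f B \<otimes> zigzag G f (B # Js)) = alternating G f (K # descent_ends (B # Js))"
      if "successively (\<lambda>A B. A \<subseteq> B \<or> B \<subseteq> A) (B # Js)" for K
      using conjunct2[OF "3.IH"(2)] that by (simp del: zigzag.simps alternating.simps descent_ends.simps)
    show ?case
    proof (intro conjI impI allI)
      assume s: "successively (\<lambda>A B. A \<subseteq> B \<or> B \<subseteq> A) (A # B # Js)"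
      show "zigzag G f (A # B # Js) = alternating G f (ascent_ends (A # B # Js))"
      proof (cases "A \<subset> B")
        case True
        then show ?thesis using s "3.IH"(2) zig_up by auto
      next
        case False
        then have "B \<subseteq> A" using s by auto
        then show ?thesis using s False IH_down[of A] zig_down by (simp del: zigzag.simps)
      qed
      fix K
      show "f K \<otimes> (inv f (hd (A # B # Js)) \<otimes> zigzag G f (A # B # Js)) =
            alternating G f (K # descent_ends (A # B # Js))"
      proof (cases "B \<subset> A")
        case True
        then have "zigzag G f (A # B # Js) = f A \<otimes> (inv f B \<otimes> zigzag G f (B # Js))"
          using zig_down by auto
        then have "inv f A \<otimes> zigzag G f (A # B # Js) = inv f B \<otimes> zigzag G f (B # Js)"
          by (simp add: inv_mult_cancel_left f_closed z del: zigzag.simps)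
        then show ?thesis using s True IH_down[of K] by (simp del: zigzag.simps)
      next
        case False
        then have "A \<subseteq> B" using s by auto
        then show ?thesis using s False "3.IH"(2) zig_up ascent by simp
      qed
    qed
  qed
  then show ?thesis using assms by blast
qed

lemma alternating_eq_list_prod:
  assumes "length Ls = 2 * m" "m \<ge> 1"
  shows "alternating G f Ls =
    list_prod G (concat (map (\<lambda>i. [f (Ls ! (2 * i - 2)), inv f (Ls ! (2 * i - 1))]) [1..<m])) \<otimes>
    f (Ls ! (2 * m - 2))"
  using assms
proof (induction m arbitrary: Ls)
  case (Suc m)
  show ?case
  proof (cases "m = 0")
    case True
    with Suc.prems obtain K I where "Ls = [K, I]"
      by (auto simp: length_Suc_conv numeral_2_eq_2)
    then show ?thesis using True by (simp add: f_closed)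
  next
    case False
    with Suc.prems obtain K I L Ms where Ls: "Ls = K # I # L # Ms"
      by (cases Ls; cases "tl Ls"; cases "tl (tl Ls)") auto
    let ?g = "\<lambda>Ls i. [f (Ls ! (2 * i - 2)), inv f (Ls ! (2 * i - 1))]"
    have shift: "?g Ls (Suc i) = ?g (L # Ms) i" if "i \<ge> 1" for i
      using that Ls by (cases i) auto
    have "[1..<Suc m] = 1 # map Suc [1..<m]"
      using False by (simp add: upt_conv_Cons map_Suc_upt del: upt_Suc)
    moreover have "map (?g Ls \<circ> Suc) [1..<m] = map (?g (L # Ms)) [1..<m]"
      by (rule map_cong[OF HOL.refl]) (simp only: comp_apply shift set_upt atLeastLessThan_iff)
    ultimately have "map (?g Ls) [1..<Suc m] = ?g Ls 1 # map (?g (L # Ms)) [1..<m]"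
      by (simp only: list.map map_map)
    moreover have "?g Ls 1 = [f K, inv f I]" by (simp add: Ls)
    ultimately have step: "concat (map (?g Ls) [1..<Suc m]) =
        f K # inv f I # concat (map (?g (L # Ms)) [1..<m])"
      by (simp only: concat.simps append.simps)
    have last: "Ls ! (2 * Suc m - 2) = (L # Ms) ! (2 * m - 2)"
      using False Ls by (cases m) auto
    have "list_prod G (concat (map (?g (L # Ms)) [1..<m])) \<in> carrier G"
      by (rule list_prod_closed) (auto simp: f_closed)
    moreover have "alternating G f (L # Ms) =
        list_prod G (concat (map (?g (L # Ms)) [1..<m])) \<otimes> f ((L # Ms) ! (2 * m - 2))"
      using False Suc.prems Ls by (intro Suc.IH) auto
    ultimately show ?thesis
      unfolding step last by (simp add: Ls m_assoc f_closed)
  qed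
qed simp

end

end

section \<open>The inversion set of an element\<close>

locale coxeter = group W for W :: "('a, 'b) monoid_scheme" (structure) +
  fixes S :: "'a set"
  assumes system: "coxeter_system W S"
begin

abbreviation len :: "'a \<Rightarrow> nat" where "len \<equiv> cox_length W S"

abbreviation conjugate :: "'a \<Rightarrow> 'a \<Rightarrow> 'a" where "conjugate x t \<equiv> x \<otimes> t \<otimes> inv x"

lemma S_carrier: "S \<subseteq> carrier W"
  using system by (simp add: coxeter_system_def)

lemma S_closed [simp]: "s \<in> S \<Longrightarrow> s \<in> carrier W"
  using S_carrier by blast

lemma square: "s \<in> S \<Longrightarrow> s \<otimes> s = \<one>"
  using system pow_ord_eq_1[of s]
  by (auto simp: coxeter_system_def numeral_2_eq_2)

lemma inv_generator: "s \<in> S \<Longrightarrow> inv s = s"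
  using square by (simp add: inv_equality)

lemma word_closed: "u \<in> lists S \<Longrightarrow> set u \<subseteq> carrier W"
  using S_carrier by auto

lemma prod_word_closed [simp]: "u \<in> lists S \<Longrightarrow> list_prod W u \<in> carrier W"
  by (simp add: list_prod_closed word_closed)

lemma generator_cancel: "s \<in> S \<Longrightarrow> x \<in> carrier W \<Longrightarrow> s \<otimes> (s \<otimes> x) = x"
  by (metis S_closed inv_generator inv_mult_cancel_left)

lemma list_prod_rev: "u \<in> lists S \<Longrightarrow> list_prod W (rev u) = inv (list_prod W u)"
  by (induction u) (auto simp: list_prod_append word_closed inv_mult_group inv_generator)

lemma generate_word:
  assumes "I \<subseteq> S" "x \<in> generate W I"
  shows "\<exists>u\<in>lists I. list_prod W u = x"
  using assms(2)
proof induction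
  case one
  then show ?case by (intro bexI[of _ "[]"]) auto
next
  case (incl h)
  then show ?case using assms(1) by (intro bexI[of _ "[h]"]) auto
next
  case (inv h)
  then show ?case using assms(1) by (intro bexI[of _ "[h]"]) (auto simp: inv_generator subset_iff)
next
  case (eng x y)
  then obtain u v where uv: "u \<in> lists I" "v \<in> lists I" "list_prod W u = x" "list_prod W v = y"
    by blast
  moreover from uv have "u \<in> lists S" "v \<in> lists S" using assms(1) by auto
  ultimately have "list_prod W (u @ v) = x \<otimes> y" by (simp add: list_prod_append word_closed)
  then show ?case using uv by (intro bexI[of _ "u @ v"]) auto
qed

lemma word_of: "x \<in> carrier W \<Longrightarrow> \<exists>u\<in>lists S. list_prod W u = x"
  using generate_word[of S x] system by (simp add: coxeter_system_def)

lemma len_le: "u \<in> lists S \<Longrightarrow> len (list_prod W u) \<le> length u"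
  unfolding cox_length_def by (rule Least_le) blast

lemma reduced_word: "x \<in> carrier W \<Longrightarrow> \<exists>u\<in>lists S. length u = len x \<and> list_prod W u = x"
  unfolding cox_length_def using word_of[of x]
  by (intro LeastI_ex[of "\<lambda>n. \<exists>u\<in>lists S. length u = n \<and> list_prod W u = x"]) blast

lemma len_inv:
  assumes "x \<in> carrier W"
  shows "len (inv x) = len x"
proof -
  have "len (inv y) \<le> len y" if y: "y \<in> carrier W" for y
  proof -
    obtain u where "u \<in> lists S" "length u = len y" "list_prod W u = y"
      using reduced_word[OF y] by blast
    moreover from this have "rev u \<in> lists S" by auto
    ultimately show ?thesis using len_le[of "rev u"] by (auto simp: list_prod_rev)
  qed
  from this[of x] this[of "inv x"] assms show ?thesis by simp
qed

primrec reflections :: "'a list \<Rightarrow> 'a list" where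
  "reflections [] = []"
| "reflections (s # u) = s # map (conjugate s) (reflections u)"

lemma conjugate_mult:
  "x \<in> carrier W \<Longrightarrow> y \<in> carrier W \<Longrightarrow> t \<in> carrier W \<Longrightarrow>
    conjugate (x \<otimes> y) t = conjugate x (conjugate y t)"
  by (simp add: inv_mult_group m_assoc)

lemma conjugate_conjugate_inv:
  "x \<in> carrier W \<Longrightarrow> t \<in> carrier W \<Longrightarrow> conjugate x (inv x \<otimes> t \<otimes> x) = t"
  by (simp add: m_assoc mult_inv_cancel_left)

lemma inj_conjugate: "x \<in> carrier W \<Longrightarrow> inj_on (conjugate x) (carrier W)"
  by (auto simp: inj_on_def)

lemma reflections_closed: "u \<in> lists S \<Longrightarrow> set (reflections u) \<subseteq> carrier W"
  by (induction u) auto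

lemma reflections_append:
  assumes "u \<in> lists S" "v \<in> lists S"
  shows "reflections (u @ v) = reflections u @ map (conjugate (list_prod W u)) (reflections v)"
  using assms(1)
proof (induction u)
  case Nil
  have "map (conjugate \<one>) (reflections v) = map id (reflections v)"
    using reflections_closed[OF assms(2)] by (intro map_cong[OF HOL.refl]) auto
  then show ?case by simp
next
  case (Cons s u)
  have "map (conjugate (s \<otimes> list_prod W u)) (reflections v) =
        map (conjugate s \<circ> conjugate (list_prod W u)) (reflections v)"
    using Cons assms(2) reflections_closed[OF assms(2)]
    by (intro map_cong[OF HOL.refl]) (simp add: conjugate_mult subset_iff)
  then show ?case using Cons assms(2) by simp
qed

text \<open>The reflections of \<open>(st)\<^sup>n\<close> are \<open>(st)\<^sup>i s\<close> for \<open>i < 2n\<close>. If \<open>(st)\<^sup>n = 1\<close> the second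
  half of this list repeats the first half, so every reflection occurs an even number of times.
  This is the only place where the form of the Coxeter relations enters.\<close>

lemma reflections_dihedral:
  assumes "s \<in> S" "t \<in> S"
  shows "reflections (concat (replicate n [s, t])) = map (\<lambda>i. (s \<otimes> t) [^] i \<otimes> s) [0..<2 * n]"
proof (induction n)
  case (Suc n)
  let ?r = "s \<otimes> t"
  have r: "?r \<in> carrier W" using assms by simp
  have step: "conjugate s (conjugate t (?r [^] i \<otimes> s)) = ?r [^] (i + 2) \<otimes> s" for i :: nat
  proof -
    have "?r [^] (i + 2) = (?r \<otimes> ?r [^] i) \<otimes> ?r"
      using r by (simp add: nat_pow_Suc2[symmetric])
    also have "\<dots> \<otimes> s = conjugate s (conjugate t (?r [^] i \<otimes> s))"
      using assms r by (simp add: m_assoc inv_generator)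
    finally show ?thesis by simp
  qed
  have "[0..<2 * Suc n] = 0 # 1 # map (\<lambda>i. i + 2) [0..<2 * n]"
    by (rule nth_equalityI) (auto simp: nth_Cons' simp del: upt_Suc)
  moreover have "conjugate s t = ?r \<otimes> s" using assms by (simp add: inv_generator)
  ultimately show ?case
    using assms r Suc.IH step by simp
qed simp

lemma list_prod_dihedral:
  assumes "s \<in> S" "t \<in> S"
  shows "list_prod W (concat (replicate n [s, t])) = (s \<otimes> t) [^] n"
proof (induction n)
  case (Suc n)
  have "(s \<otimes> t) [^] Suc n = (s \<otimes> t) \<otimes> (s \<otimes> t) [^] n"
    using assms by (simp only: nat_pow_Suc2 m_closed S_closed)
  then show ?case using Suc assms by (simp add: m_assoc)
qed simp

lemma parity_reflections_cong:
  "coxeter_cong W S u v \<Longrightarrow>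
    even (count_list (reflections u) t) \<longleftrightarrow> even (count_list (reflections v) t)"
proof (induction rule: coxeter_cong.induct)
  case (relation u v a b)
  let ?n = "group.ord W (a \<otimes> b)"
  let ?R = "concat (replicate ?n [a, b])"
  let ?r = "\<lambda>i::nat. (a \<otimes> b) [^] i \<otimes> a"
  have R: "?R \<in> lists S" using relation by (auto split: if_splits)
  have one: "(a \<otimes> b) [^] ?n = \<one>"
    using relation by (intro pow_ord_eq_1) simp
  have "[0..<2 * ?n] = [0..<?n] @ map (\<lambda>i. i + ?n) [0..<?n]"
    by (rule nth_equalityI) (auto simp: nth_append)
  moreover have "map (?r \<circ> (\<lambda>i. i + ?n)) [0..<?n] = map ?r [0..<?n]"
    using relation one by (simp add: nat_pow_mult[symmetric])
  ultimately have "reflections ?R = map ?r [0..<?n] @ map ?r [0..<?n]"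
    using relation by (simp add: reflections_dihedral)
  moreover have "list_prod W (u @ ?R) = list_prod W u"
    using relation R one by (simp add: list_prod_append word_closed list_prod_dihedral)
  then have "reflections ((u @ ?R) @ v) = reflections u @
      map (conjugate (list_prod W u)) (reflections ?R) @
      map (conjugate (list_prod W u)) (reflections v)"
    using relation R by (subst reflections_append) (auto simp: reflections_append simp del: in_lists_conv_set)
  ultimately show ?case
    using relation by (auto simp: reflections_append)
qed auto

definition inversions :: "'a \<Rightarrow> 'a set" where
  "inversions x =
     {t. odd (count_list (reflections (SOME u. u \<in> lists S \<and> list_prod W u = x)) t)}"

lemma inversions_word:
  assumes "u \<in> lists S"
  shows "inversions (list_prod W u) = {t. odd (count_list (reflections u) t)}"
proof -
  define v where "v = (SOME v. v \<in> lists S \<and> list_prod W v = list_prod W u)"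
  have "v \<in> lists S \<and> list_prod W v = list_prod W u"
    unfolding v_def by (rule someI[of _ u]) (use assms in simp)
  then have "coxeter_cong W S v u"
    using system assms by (auto simp: coxeter_system_def)
  then show ?thesis
    unfolding inversions_def v_def[symmetric] using parity_reflections_cong by blast
qed

lemma inversions_subset_reflections:
  assumes "u \<in> lists S"
  shows "inversions (list_prod W u) \<subseteq> set (reflections u)"
proof
  fix t assume "t \<in> inversions (list_prod W u)"
  then have "count_list (reflections u) t \<noteq> 0"
    using assms by (auto simp: inversions_word intro: odd_pos)
  then show "t \<in> set (reflections u)" by (simp add: count_list_0_iff)
qed

lemma inversions_closed: "x \<in> carrier W \<Longrightarrow> inversions x \<subseteq> carrier W"
  using word_of[of x] inversions_subset_reflections reflections_closed by blast

lemma inversions_one [simp]: "inversions \<one> = {}"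
  using inversions_word[of "[]"] by simp

lemma inversions_generator: "s \<in> S \<Longrightarrow> inversions s = {s}"
  using inversions_word[of "[s]"] by auto

lemma inversions_mult:
  assumes "x \<in> carrier W" "y \<in> carrier W" "t \<in> carrier W"
  shows "t \<in> inversions (x \<otimes> y) \<longleftrightarrow> (t \<in> inversions x) \<noteq> (inv x \<otimes> t \<otimes> x \<in> inversions y)"
proof -
  obtain u v where uv: "u \<in> lists S" "v \<in> lists S" "list_prod W u = x" "list_prod W v = y"
    using word_of assms by meson
  have count: "count_list (map (conjugate x) ts) (conjugate x t') = count_list ts t'"
    if "set ts \<subseteq> carrier W" "t' \<in> carrier W" for ts t'
    using that inj_conjugate[OF assms(1)] by (induction ts) (auto simp: inj_on_def)
  have "count_list (map (conjugate x) (reflections v)) (conjugate x (inv x \<otimes> t \<otimes> x)) =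
      count_list (reflections v) (inv x \<otimes> t \<otimes> x)"
    using assms uv by (intro count reflections_closed) auto
  then have "count_list (map (conjugate x) (reflections v)) t =
      count_list (reflections v) (inv x \<otimes> t \<otimes> x)"
    using assms by (simp add: conjugate_conjugate_inv)
  moreover have "x \<otimes> y = list_prod W (u @ v)"
    using uv by (simp add: list_prod_append word_closed)
  moreover have "inversions (list_prod W (u @ v)) = {t. odd (count_list (reflections (u @ v)) t)}"
    using uv by (intro inversions_word) auto
  moreover have "reflections (u @ v) = reflections u @ map (conjugate x) (reflections v)"
    using uv reflections_append by blast
  ultimately show ?thesis
    using uv inversions_word[of u] inversions_word[of v] by simp
qed

section \<open>Inversions count the length\<close>

text \<open>Multiplying by the \<open>i\<close>-th reflection of a word deletes the \<open>i\<close>-th letter.\<close>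

lemma delete_letter:
  assumes "u \<in> lists S" "t \<in> set (reflections u)"
  shows "\<exists>v\<in>lists S. Suc (length v) = length u \<and> list_prod W v = t \<otimes> list_prod W u"
  using assms
proof (induction u arbitrary: t)
  case (Cons s u)
  then have s: "s \<in> S" "u \<in> lists S" by auto
  show ?case
  proof (cases "t = s")
    case True
    then show ?thesis
      using s by (intro bexI[of _ u]) (simp_all add: generator_cancel)
  next
    case False
    then obtain t' where t': "t' \<in> set (reflections u)" "t = conjugate s t'"
      using Cons.prems by auto
    then obtain v where v: "v \<in> lists S" "Suc (length v) = length u"
      "list_prod W v = t' \<otimes> list_prod W u"
      using Cons.IH by blast
    have "t' \<in> carrier W" using t' s reflections_closed[of u] by blast
    then have "list_prod W (s # v) = t \<otimes> list_prod W (s # u)"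
      using v t' s by (simp add: m_assoc inv_mult_cancel_left)
    then show ?thesis
      using v s by (intro bexI[of _ "s # v"]) auto
  qed
qed simp

text \<open>A repetition among the reflections of a word would allow two letters to be deleted without
  changing the element. By induction on the word it suffices to treat a repetition of the first
  reflection \<open>s\<close>, which means that \<open>s\<close> deletes a letter from the rest of the word.\<close>

lemma distinct_reflections:
  assumes "u \<in> lists S" "len (list_prod W u) = length u"
  shows "distinct (reflections u)"
  using assms
proof (induction u)
  case (Cons s u)
  then have s: "s \<in> S" and u: "u \<in> lists S" by auto
  have "len (list_prod W u) = length u"
  proof -
    obtain v where v: "v \<in> lists S" "length v = len (list_prod W u)" "list_prod W v = list_prod W u"
      using reduced_word u prod_word_closed by meson
    then have "len (list_prod W (s # u)) \<le> Suc (length v)"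
      using len_le[of "s # v"] s by simp
    then show ?thesis
      using Cons.prems v len_le[OF u] by simp
  qed
  then have "distinct (reflections u)" using Cons.IH u by simp
  then have "distinct (map (conjugate s) (reflections u))"
    using inj_on_subset[OF inj_conjugate reflections_closed[OF u]] s by (simp add: distinct_map)
  moreover have "s \<notin> conjugate s ` set (reflections u)"
  proof
    assume "s \<in> conjugate s ` set (reflections u)"
    then obtain t where t: "t \<in> set (reflections u)" "conjugate s t = s" by auto
    moreover have "conjugate s s = s" using s by (simp add: m_assoc)
    ultimately have "t = s"
      using inj_conjugate[of s] s reflections_closed[OF u] by (metis S_closed inj_onD subsetD)
    then obtain v where "v \<in> lists S" "Suc (length v) = length u"
      "list_prod W v = list_prod W (s # u)"
      using delete_letter[OF u t(1)] by auto
    then show False using len_le[of v] Cons.prems by simp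
  qed
  ultimately show ?case by simp
qed simp

lemma inversions_reduced_word:
  assumes "u \<in> lists S" "len (list_prod W u) = length u"
  shows "inversions (list_prod W u) = set (reflections u)"
proof -
  have "distinct ts \<Longrightarrow> {t. odd (count_list ts t)} = set ts" for ts :: "'a list"
    by (induction ts) auto
  then show ?thesis
    using assms by (simp add: inversions_word distinct_reflections)
qed

lemma length_reflections [simp]: "length (reflections u) = length u"
  by (induction u) auto

lemma card_inversions:
  assumes "x \<in> carrier W"
  shows "card (inversions x) = len x"
proof -
  obtain u where "u \<in> lists S" "length u = len x" "list_prod W u = x"
    using reduced_word[OF assms] by blast
  then show ?thesis
    using inversions_reduced_word[of u] distinct_reflections[of u] distinct_card by fastforce
qed

lemma finite_inversions: "x \<in> carrier W \<Longrightarrow> finite (inversions x)"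
  using word_of[of x] inversions_subset_reflections finite_subset by blast

lemma len_mult_inversion:
  assumes "x \<in> carrier W" "t \<in> inversions x"
  shows "len (t \<otimes> x) < len x"
proof -
  obtain u where u: "u \<in> lists S" "length u = len x" "list_prod W u = x"
    using reduced_word[OF assms(1)] by blast
  then obtain v where "v \<in> lists S" "Suc (length v) = length u" "list_prod W v = t \<otimes> x"
    using delete_letter[OF u(1)] inversions_subset_reflections[OF u(1)] assms(2) by blast
  then show ?thesis using len_le[of v] u by simp
qed

text \<open>This makes the cocycle rule for \<open>t \<otimes> w\<close> toggle membership of the reflection \<open>t\<close>
  itself, so that \<open>t\<close> is an inversion of exactly one of \<open>w\<close> and \<open>t \<otimes> w\<close>, which is then the
  longer one.\<close>

lemma reflection_inverts_itself:
  assumes "x \<in> carrier W" "s \<in> S"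
  shows "conjugate x s \<in> inversions (conjugate x s)"
proof -
  let ?t = "conjugate x s"
  have t: "?t \<in> carrier W" and s: "s \<in> carrier W" using assms by auto
  have conj_back: "inv x \<otimes> ?t \<otimes> x = s"
    using assms by (simp add: m_assoc inv_mult_cancel_left)
  have "?t \<in> inversions (x \<otimes> (s \<otimes> inv x)) \<longleftrightarrow> (?t \<in> inversions x) \<noteq> (s \<in> inversions (s \<otimes> inv x))"
    using inversions_mult[of x "s \<otimes> inv x" ?t] assms t conj_back by simp
  moreover have "s \<in> inversions (s \<otimes> inv x) \<longleftrightarrow> s \<notin> inversions (inv x)"
    using inversions_mult[of s "inv x" s] assms by (simp add: inversions_generator)
  \<comment> \<open>the two remaining contributions agree because \<open>x\<close> and \<open>inv x\<close> multiply to the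
      identity, which has no inversions\<close>
  moreover have "?t \<in> inversions x \<longleftrightarrow> s \<in> inversions (inv x)"
    using inversions_mult[of x "inv x" ?t] assms t conj_back by simp
  ultimately show ?thesis using assms by (simp add: m_assoc)
qed

lemma len_mult_noninversion:
  assumes "x \<in> carrier W" "s \<in> S" "w \<in> carrier W" "conjugate x s \<notin> inversions w"
  shows "len w < len (conjugate x s \<otimes> w)"
proof -
  let ?t = "conjugate x s"
  have t: "?t \<in> carrier W" using assms by simp
  have tt: "?t \<otimes> ?t = \<one>"
    using assms by (simp add: m_assoc inv_mult_cancel_left square flip: m_assoc[of s s])
  have "inv ?t \<otimes> ?t \<otimes> ?t = ?t" using t by simp
  then have "?t \<in> inversions (?t \<otimes> w)"
    using inversions_mult[of ?t w ?t] assms t reflection_inverts_itself by simp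
  then have "len (?t \<otimes> (?t \<otimes> w)) < len (?t \<otimes> w)"
    using assms t by (intro len_mult_inversion) auto
  moreover have "?t \<otimes> (?t \<otimes> w) = w"
    using tt t assms(3) by (metis l_one m_assoc)
  ultimately show ?thesis by simp
qed

section \<open>Longest elements of finite parabolic subgroups\<close>

definition parabolic_reflections :: "'a set \<Rightarrow> 'a set" where
  "parabolic_reflections I = {conjugate x s | x s. x \<in> generate W I \<and> s \<in> I}"

lemma conjugate_parabolic_reflection:
  assumes "I \<subseteq> S" "x \<in> generate W I" "t \<in> parabolic_reflections I"
  shows "conjugate x t \<in> parabolic_reflections I"
proof -
  obtain y s where ys: "y \<in> generate W I" "s \<in> I" "t = conjugate y s"
    using assms(3) by (auto simp: parabolic_reflections_def)
  have "I \<subseteq> carrier W" using assms(1) S_carrier by blast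
  then have "conjugate x t = conjugate (x \<otimes> y) s"
    using ys assms generate_in_carrier[of I] by (subst conjugate_mult) auto
  then show ?thesis
    using ys assms generate.eng by (fastforce simp: parabolic_reflections_def)
qed

lemma inversions_parabolic:
  assumes "I \<subseteq> S" "x \<in> generate W I"
  shows "inversions x \<subseteq> parabolic_reflections I"
proof -
  have word: "u \<in> lists I \<Longrightarrow> set (reflections u) \<subseteq> parabolic_reflections I" for u
  proof (induction u)
    case (Cons s u)
    have "conjugate \<one> s = s" using Cons.prems assms(1) by auto
    then have "s \<in> parabolic_reflections I"
      using Cons.prems generate.one[of W I] unfolding parabolic_reflections_def
      by (intro CollectI exI[of _ \<one>] exI[of _ s]) auto
    then show ?case
      using Cons conjugate_parabolic_reflection[OF assms(1) generate.incl[of s I W]] by auto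
  qed simp
  obtain u where "u \<in> lists I" "list_prod W u = x"
    using generate_word[OF assms] by blast
  then show ?thesis
    using word inversions_subset_reflections[of u] assms(1) lists_mono by blast
qed

lemma parabolic_carrier: "I \<subseteq> S \<Longrightarrow> generate W I \<subseteq> carrier W"
  using S_carrier generate_incl[of I] by blast

lemma inversions_of_maximal:
  assumes "I \<subseteq> S" "w \<in> generate W I" "\<forall>v\<in>generate W I. len v \<le> len w"
  shows "inversions w = parabolic_reflections I"
proof
  show "inversions w \<subseteq> parabolic_reflections I"
    using inversions_parabolic assms by blast
  show "parabolic_reflections I \<subseteq> inversions w"
  proof
    fix t assume "t \<in> parabolic_reflections I"
    then obtain x s where xs: "x \<in> generate W I" "s \<in> I" "t = conjugate x s"
      by (auto simp: parabolic_reflections_def)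
    have "inv x \<in> generate W I"
      using xs(1) assms(1) S_carrier generate_m_inv_closed by (meson subset_trans)
    then have "t \<otimes> w \<in> generate W I"
      unfolding xs(3) using xs(1,2) assms(2) by (intro generate.eng) (auto intro: generate.incl)
    then show "t \<in> inversions w"
      using len_mult_noninversion[of x s w] xs assms parabolic_carrier[OF assms(1)]
      by (meson leD subsetD)
  qed
qed

text \<open>The cocycle rule for \<open>y = x \<otimes> (inv x \<otimes> y)\<close> leaves no inversions, hence length zero, for
  \<open>inv x \<otimes> y\<close>. In particular the element of maximal length is unique.\<close>

lemma eq_if_inversions_eq:
  assumes "x \<in> carrier W" "y \<in> carrier W" "inversions x = inversions y"
  shows "x = y"
proof -
  let ?z = "inv x \<otimes> y"
  have z: "?z \<in> carrier W" using assms by simp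
  have "t \<notin> inversions ?z" if t: "t \<in> carrier W" for t
  proof -
    have c: "conjugate x t \<in> carrier W" using t assms by simp
    have "inv x \<otimes> conjugate x t \<otimes> x = t"
      using t assms by (simp add: m_assoc inv_mult_cancel_left)
    moreover have "x \<otimes> ?z = y" using assms by (simp add: mult_inv_cancel_left)
    ultimately show ?thesis
      using inversions_mult[OF assms(1) z c] assms(3) by simp blast
  qed
  then have "inversions ?z = {}" using inversions_closed[OF z] by blast
  then have "len ?z = 0" using card_inversions[OF z] by simp
  then have "?z = \<one>" using reduced_word[OF z] by auto
  then show ?thesis using assms
    by (metis inv_closed inv_equality inv_inv)
qed

lemma longest_maximal:
  assumes "finitary W S I"
  shows "longest W S I \<in> generate W I \<and> (\<forall>v\<in>generate W I. len v \<le> len (longest W S I))"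
proof -
  have I: "I \<subseteq> S" "finite (generate W I)" using assms by (auto simp: finitary_def)
  have "\<exists>w\<in>generate W I. len w = Max (len ` generate W I)"
    using I(2) generate.one by (metis Max_in empty_iff finite_imageI image_iff image_is_empty)
  then obtain w where "w \<in> generate W I" "\<forall>v\<in>generate W I. len v \<le> len w"
    using I(2) by auto
  then have "\<exists>!w. w \<in> generate W I \<and> (\<forall>v\<in>generate W I. len v \<le> len w)"
    using inversions_of_maximal[OF I(1)] eq_if_inversions_eq parabolic_carrier[OF I(1)]
    by (metis subsetD)
  then show ?thesis unfolding longest_def by (rule theI')
qed

lemma longest_closed: "finitary W S I \<Longrightarrow> longest W S I \<in> carrier W"
  using longest_maximal parabolic_carrier unfolding finitary_def by blast

lemma inversions_longest: "finitary W S I \<Longrightarrow> inversions (longest W S I) = parabolic_reflections I"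
  using longest_maximal inversions_of_maximal unfolding finitary_def by blast

lemma inv_longest:
  assumes "finitary W S I"
  shows "inv (longest W S I) = longest W S I"
proof -
  let ?w = "longest W S I"
  have I: "I \<subseteq> S" using assms by (simp add: finitary_def)
  then have "inv ?w \<in> generate W I"
    using longest_maximal[OF assms] S_carrier generate_m_inv_closed by (meson subset_trans)
  then have "inversions (inv ?w) = parabolic_reflections I"
    using longest_maximal[OF assms] longest_closed[OF assms]
    by (intro inversions_of_maximal[OF I]) (auto simp: len_inv)
  then show ?thesis
    using inversions_longest[OF assms] longest_closed[OF assms] eq_if_inversions_eq by simp
qed

text \<open>By the cocycle rule, conjugation by \<open>x\<close> permutes the full set of reflections of the
  parabolic subgroup, so the inversions of \<open>x \<otimes> w\<close> are the complement of those of \<open>x\<close>.\<close>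

lemma length_mult_longest:
  assumes "finitary W S I" "x \<in> generate W I"
  shows "len (x \<otimes> longest W S I) + len x = len (longest W S I)"
proof -
  let ?w = "longest W S I" and ?T = "parabolic_reflections I"
  have I: "I \<subseteq> S" using assms by (simp add: finitary_def)
  have x: "x \<in> carrier W" using assms(2) parabolic_carrier[OF I] by blast
  have w: "?w \<in> carrier W" using longest_closed[OF assms(1)] .
  have ix: "inv x \<in> generate W I"
    using assms(2) I S_carrier generate_m_inv_closed by (meson subset_trans)
  have T: "inversions ?w = ?T" using inversions_longest[OF assms(1)] .
  have conj_T: "inv x \<otimes> t \<otimes> x \<in> ?T \<longleftrightarrow> t \<in> ?T" if "t \<in> carrier W" for t
    using conjugate_parabolic_reflection[OF I ix, of t] that x
      conjugate_parabolic_reflection[OF I assms(2), of "inv x \<otimes> t \<otimes> x"]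
    by (auto simp: conjugate_conjugate_inv)
  have sub: "inversions x \<subseteq> ?T" using inversions_parabolic[OF I assms(2)] .
  have "inversions (x \<otimes> ?w) = ?T - inversions x"
  proof (rule Set.set_eqI)
    fix t
    show "t \<in> inversions (x \<otimes> ?w) \<longleftrightarrow> t \<in> ?T - inversions x"
    proof (cases "t \<in> carrier W")
      case True
      then show ?thesis
        using inversions_mult[OF x w True] conj_T[OF True] sub unfolding T by blast
    next
      case False
      then show ?thesis
        using inversions_closed[of "x \<otimes> ?w"] inversions_closed[OF w] x w T by auto
    qed
  qed
  then have "len (x \<otimes> ?w) = card ?T - card (inversions x)"
    using card_inversions[of "x \<otimes> ?w"] x w card_Diff_subset[OF finite_inversions[OF x] sub] by simp
  moreover have "card (inversions x) \<le> card ?T"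
    using sub finite_inversions[OF w] T by (simp add: card_mono)
  ultimately show ?thesis
    using card_inversions[OF x] card_inversions[OF w] T by simp
qed

text \<open>Inversion preserves lengths and exchanges left and right multiplication, and the longest
  element is its own inverse.\<close>

lemma length_longest_mult:
  assumes "finitary W S I" "x \<in> generate W I"
  shows "len (longest W S I \<otimes> x) + len x = len (longest W S I)"
proof -
  have I: "I \<subseteq> S" using assms by (simp add: finitary_def)
  have x: "x \<in> carrier W" using assms(2) parabolic_carrier[OF I] by blast
  have w: "longest W S I \<in> carrier W" using longest_closed[OF assms(1)] .
  have "inv x \<in> generate W I"
    using assms(2) I S_carrier generate_m_inv_closed by (meson subset_trans)
  from length_mult_longest[OF assms(1) this]
  have "len (inv x \<otimes> inv (longest W S I)) + len x = len (longest W S I)"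
    using x assms(1) by (simp add: inv_longest len_inv)
  then show ?thesis
    using x w len_inv[of "longest W S I \<otimes> x"] by (simp add: inv_mult_group)
qed

lemma finitary_subset: "finitary W S A \<Longrightarrow> B \<subseteq> A \<Longrightarrow> finitary W S B"
  unfolding finitary_def using mono_generate[of B A] finite_subset by blast

lemma length_longest_quotients:
  assumes "finitary W S A" "B \<subseteq> A"
  shows "int (len (longest W S A \<otimes> inv (longest W S B))) =
           int (len (longest W S A)) - int (len (longest W S B))"
    and "int (len (inv (longest W S B) \<otimes> longest W S A)) =
           int (len (longest W S A)) - int (len (longest W S B))"
proof -
  have "longest W S B \<in> generate W A"
    using longest_maximal[OF finitary_subset[OF assms]] mono_generate[OF assms(2)] by blast
  then show "int (len (longest W S A \<otimes> inv (longest W S B))) =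
           int (len (longest W S A)) - int (len (longest W S B))"
    and "int (len (inv (longest W S B) \<otimes> longest W S A)) =
           int (len (longest W S A)) - int (len (longest W S B))"
    using length_longest_mult[OF assms(1)] length_mult_longest[OF assms(1)]
      inv_longest[OF finitary_subset[OF assms]] by (simp_all, fastforce+)
qed

end

section \<open>The two criteria\<close>

lemma length_multistep_ends:
  "J \<noteq> [] \<Longrightarrow> even (length (ascent_ends J)) \<and> ascent_ends J \<noteq> [] \<and> odd (length (descent_ends J))"
  by (induction J rule: induct_list012) auto

lemma set_multistep_ends: "set (ascent_ends J) \<subseteq> set J \<and> set (descent_ends J) \<subseteq> set J"
  by (induction J rule: induct_list012) auto

lemma sum_list_alternating:
  fixes a b :: "nat \<Rightarrow> int"
  assumes "m \<ge> 1"
  shows "sum_list (concat (map (\<lambda>i. [a i, - b i]) [1..<m])) + a m =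
    (\<Sum>i = 1..m. a i) - (\<Sum>i = 1..<m. b i)"
  using assms by (induction m rule: dec_induct) (auto simp: sum.atLeastLessThan_Suc)

lemma successively_comparable:
  assumes "singular_expression W S J"
  shows "successively (\<lambda>A B. A \<subseteq> B \<or> B \<subseteq> A) J"
proof -
  have "J ! i \<subseteq> J ! Suc i \<or> J ! Suc i \<subseteq> J ! i" if "Suc i < length J" for i
    using assms that by (fastforce simp: singular_expression_def)
  then show ?thesis by (simp add: successively_conv_nth)
qed

lemma (in coxeter) lengths_add_iff_multistep_length_formula:
  assumes J: "singular_expression W S J" and k: "k < length J"
  shows "lengths_add W S (factors_at W S J k) \<longleftrightarrow> multistep_length_formula W S J"
proof -
  interpret Z: group integer_group by simp
  \<comment> \<open>the telescoping lemmas need values in the group at every set, and \<open>longest\<close> is only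
      meaningful at finitary sets\<close>
  define w where "w I = (if finitary W S I then longest W S I else \<one>)" for I
  define l where "l I = int (len (w I))" for I
  have w_closed: "w I \<in> carrier W" for I
    by (simp add: w_def longest_closed)
  have fin: "finitary W S I" if "I \<in> set J" for I
    using J that by (simp add: singular_expression_def)
  have fin_nth: "finitary W S (J ! i)" if "i < length J" for i
    using fin that by simp
  have fin_int: "finitary W S (J ! i \<inter> A)" "finitary W S (A \<inter> J ! i)" if "i < length J" for i A
    using finitary_subset[OF fin_nth[OF that]] by auto
  have comparable: "successively (\<lambda>A B. A \<subseteq> B \<or> B \<subseteq> A) J" and "J \<noteq> []"
    using successively_comparable[OF J] k by auto

  have factors: "factors_at W S J k = slices W w J k"
    using k by (auto simp: factors_at_def slices_def y_factor_def z_factor_def w_def fin_nth fin_int)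
  have "map (int \<circ> len) (slices W w J k) = slices integer_group l J k"
    using k by (auto simp: slices_def l_def w_def fin_nth fin_int length_longest_quotients)
  moreover have sum: "int (\<Sum>x\<leftarrow>xs. len x) = sum_list (map (int \<circ> len) xs)" for xs
    by (induction xs) auto
  ultimately have lengths: "int (\<Sum>x\<leftarrow>slices W w J k. len x) = list_prod integer_group (slices integer_group l J k)"
    by (simp add: list_prod_integer_group sum)

  define Ls where "Ls = ascent_ends J"
  define m where "m = multistep_m J"
  have Ls: "length Ls = 2 * m"
    using length_multistep_ends[OF \<open>J \<noteq> []\<close>]
    by (auto simp: Ls_def m_def multistep_m_def multistep_def elim!: evenE)
  then have "m \<ge> 1"
    using length_multistep_ends[OF \<open>J \<noteq> []\<close>] by (cases m) (auto simp: Ls_def)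
  have K: "multistep_K J i = Ls ! (2 * i - 2)" and I: "multistep_I J i = Ls ! (2 * i - 1)"
    if "i \<ge> 1" for i
    using that by (cases i; simp add: multistep_K_def multistep_I_def multistep_def Ls_def)+
  have "finitary W S (Ls ! i)" if "i < 2 * m" for i
    using that fin set_multistep_ends[of J] Ls unfolding Ls_def
    by (metis nth_mem subsetD)
  then have wK: "longest W S (multistep_K J i) = w (Ls ! (2 * i - 2))"
    and wI: "longest W S (multistep_I J i) = w (Ls ! (2 * i - 1))" if "i \<ge> 1" "i \<le> m" for i
    using that by (auto simp: K I w_def)
  have "multistep_prod W S J = alternating W w Ls"
  proof -
    have "map (\<lambda>i. [longest W S (multistep_K J i), inv (longest W S (multistep_I J i))]) [1..<m] =
        map (\<lambda>i. [w (Ls ! (2 * i - 2)), inv w (Ls ! (2 * i - 1))]) [1..<m]"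
      by (rule map_cong[OF HOL.refl]) (simp only: wK wI set_upt atLeastLessThan_iff less_imp_le)
    then show ?thesis
      unfolding multistep_prod_def alternating_eq_list_prod[OF w_closed Ls \<open>m \<ge> 1\<close>] m_def[symmetric]
      using \<open>m \<ge> 1\<close> by (simp only: wK order.refl)
  qed
  moreover have "(\<Sum>i = 1..m. int (len (longest W S (multistep_K J i))))
       - (\<Sum>i = 1..<m. int (len (longest W S (multistep_I J i)))) = alternating integer_group l Ls"
  proof -
    have "(\<Sum>i = 1..m. int (len (longest W S (multistep_K J i)))) = (\<Sum>i = 1..m. l (Ls ! (2 * i - 2)))"
      "(\<Sum>i = 1..<m. int (len (longest W S (multistep_I J i)))) = (\<Sum>i = 1..<m. l (Ls ! (2 * i - 1)))"
      by (rule sum.cong[OF HOL.refl]; simp only: wK wI l_def atLeastLessThan_iff atLeastAtMost_iff less_imp_le)+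
    then show ?thesis
      using Z.alternating_eq_list_prod[OF _ Ls \<open>m \<ge> 1\<close>, of l]
        sum_list_alternating[OF \<open>m \<ge> 1\<close>, of "\<lambda>i. l (Ls ! (2 * i - 2))" "\<lambda>i. l (Ls ! (2 * i - 1))"]
      by (simp add: list_prod_integer_group)
  qed
  moreover have "list_prod W (slices W w J k) = alternating W w Ls"
    using list_prod_slices[OF w_closed k] zigzag_eq_alternating[OF w_closed comparable \<open>J \<noteq> []\<close>]
    by (simp add: Ls_def)
  moreover have "list_prod integer_group (slices integer_group l J k) = alternating integer_group l Ls"
    using Z.list_prod_slices[OF _ k, of l] Z.zigzag_eq_alternating[OF _ comparable \<open>J \<noteq> []\<close>, of l]
    by (simp add: Ls_def)
  ultimately show ?thesis
    using lengths
    unfolding lengths_add_def multistep_length_formula_def factors m_def[symmetric] by (metis of_nat_eq_iff)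
qed

theorem lemma3p8:
  fixes W :: "('a, 'b) monoid_scheme" and S :: "'a set" and J :: "'a set list" and d :: nat
  assumes "coxeter_system W S"
    and "singular_expression W S J"
    and "length J = d + 1"
  shows "((\<exists>k\<le>d. lengths_add W S (factors_at W S J k)) \<longleftrightarrow> multistep_length_formula W S J) \<and>
         ((\<forall>k\<le>d. lengths_add W S (factors_at W S J k)) \<longleftrightarrow> multistep_length_formula W S J)"
proof -
  interpret coxeter W S
    using assms(1) by (auto simp: coxeter_def coxeter_axioms_def coxeter_system_def)
  have "lengths_add W S (factors_at W S J k) \<longleftrightarrow> multistep_length_formula W S J" if "k \<le> d" for k
    using lengths_add_iff_multistep_length_formula[OF assms(2)] assms(3) that by simp
  then show ?thesis by blast
qed

end
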